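(* Let $M$ be a closed radiant affine $n$-manifold ($n\ge 1$) with developing pair $(\mathrm{dev},\mathrm{hol})$, and let $x_0\in\mathbb{A}^n$ be a point fixed by every element of $\mathrm{hol}(\pi_1(M))$. Then $x_0\notin\mathrm{dev}(\widetilde M)$.
   Context: An $n$-dimensional affine manifold is a smooth $n$-manifold $M$ with an atlas of charts into $\mathbb{A}^n$ whose transition maps are, on each connected component of each overlap, restrictions of affine automorphisms. Such a structure determines a developing pair $(\mathrm{dev},\mathrm{hol})$: a local diffeomorphism $\mathrm{dev}:\widetilde M\to\mathbb{A}^n$ on the universal cover and a homomorphism $\mathrm{hol}:\pi_1(M,p)\to\mathrm{Aff}(n,\mathbb{R})$ with $\mathrm{dev}\circ\gamma=\mathrm{hol}(\gamma)\circ\mathrm{dev}$ for every deck transformation $\gamma$. The manifold is radiant if its holonomy group fixes a point of $\mathbb{A}^n$, equivalently if the holonomy is conjugate into $\mathrm{GL}(n,\mathbb{R})$. *)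

theory Defs
  imports "HOL-Analysis.Analysis"
begin

definition affine_aut :: "(real^'n \<Rightarrow> real^'n) \<Rightarrow> bool" where
  "affine_aut f \<longleftrightarrow> (\<exists>L b. linear L \<and> bij L \<and> f = (\<lambda>x. L x + b))"

definition affine_atlas ::
  "'m::topological_space set \<Rightarrow> ('m set \<times> ('m \<Rightarrow> real^'n)) set \<Rightarrow> bool" where
  "affine_atlas M A \<longleftrightarrow>
     \<Union>(fst ` A) = M \<and>
     (\<forall>(U, \<phi>)\<in>A. openin (top_of_set M) U \<and> open (\<phi> ` U) \<and>
                   (\<exists>g. homeomorphism U (\<phi> ` U) \<phi> g)) \<and>
     (\<forall>(U, \<phi>)\<in>A. \<forall>(V, \<psi>)\<in>A. \<forall>y\<in>\<phi> ` (U \<inter> V).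
        \<exists>T. affine_aut T \<and>
            (\<forall>z\<in>connected_component_set (\<phi> ` (U \<inter> V)) y. \<psi> (inv_into U \<phi> z) = T z))"

text \<open>Closed (compact, connected) affine manifold: M carries an affine atlas;
  Hausdorffness is imposed via the type class t2_space in the theorem.\<close>
definition closed_affine_manifold ::
  "'m::topological_space set \<Rightarrow> ('m set \<times> ('m \<Rightarrow> real^'n)) set \<Rightarrow> bool" where
  "closed_affine_manifold M A \<longleftrightarrow> compact M \<and> connected M \<and> affine_atlas M A"

definition universal_cover ::
  "'c::topological_space set \<Rightarrow> ('c \<Rightarrow> 'm::topological_space) \<Rightarrow> 'm set \<Rightarrow> bool" where
  "universal_cover Mt p M \<longleftrightarrow> covering_space Mt p M \<and> path_connected Mt \<and> simply_connected Mt"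

definition deck_transformation ::
  "'c::topological_space set \<Rightarrow> ('c \<Rightarrow> 'm) \<Rightarrow> ('c \<Rightarrow> 'c) \<Rightarrow> bool" where
  "deck_transformation Mt p \<gamma> \<longleftrightarrow>
     (\<exists>\<gamma>'. homeomorphism Mt Mt \<gamma> \<gamma>') \<and> (\<forall>y\<in>Mt. p (\<gamma> y) = p y)"

text \<open>Developing map: locally it is a chart (composed with p) followed by an affine
  automorphism, i.e. a local affine isomorphism for the pulled back affine structure.\<close>
definition developing_map ::
  "'c::topological_space set \<Rightarrow> ('c \<Rightarrow> 'm) \<Rightarrow> ('m set \<times> ('m \<Rightarrow> real^'n)) set
     \<Rightarrow> ('c \<Rightarrow> real^'n) \<Rightarrow> bool" where
  "developing_map Mt p A dev \<longleftrightarrow>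
     (\<forall>x\<in>Mt. \<exists>W U \<phi> T. x \<in> W \<and> openin (top_of_set Mt) W \<and> (U, \<phi>) \<in> A \<and>
        p ` W \<subseteq> U \<and> affine_aut T \<and> (\<forall>y\<in>W. dev y = T (\<phi> (p y))))"

text \<open>Holonomy (on the deck group, canonically isomorphic to pi_1(M,p)).\<close>
definition holonomy ::
  "'c::topological_space set \<Rightarrow> ('c \<Rightarrow> 'm) \<Rightarrow> ('c \<Rightarrow> real^'n)
     \<Rightarrow> (('c \<Rightarrow> 'c) \<Rightarrow> (real^'n \<Rightarrow> real^'n)) \<Rightarrow> bool" where
  "holonomy Mt p dev hol \<longleftrightarrow>
     (\<forall>\<gamma>. deck_transformation Mt p \<gamma> \<longrightarrow>
        affine_aut (hol \<gamma>) \<and> (\<forall>y\<in>Mt. dev (\<gamma> y) = hol \<gamma> (dev y))) \<and>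
     (\<forall>\<gamma> \<delta>. deck_transformation Mt p \<gamma> \<longrightarrow> deck_transformation Mt p \<delta> \<longrightarrow>
        hol (\<gamma> \<circ> \<delta>) = hol \<gamma> \<circ> hol \<delta>)"

end

(* Move x0 to the origin and suppose dev q0 = 0. The holonomy is then linear, so by compactness of M
   and transitivity of the deck group on fibres there is one constant c > 1 such that, for every z
   in the universal cover, the segment from dev z to c * dev z lifts at z. Iterating this expansion
   from q0 yields a global continuous section g of dev over R^n. By uniqueness of lifts g o dev is
   the identity, so dev is a homeomorphism onto R^n; every deck transformation fixes q0 and is
   therefore trivial, so the covering map is injective and R^n would be homeomorphic to the compact
   space M.

   The graphs of deck transformations are the path components of the fibre product of the cover
   with itself. *)
theory Submission
  imports Defs
begin

text \<open>The obstacle is that \<open>dev\<close> is only a local homeomorphism, so a path in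
  affine space need not lift. The factor c repairs this along rays from the origin: a segment from
  y/c to y lifts from every point over y/c, and finitely many such segments reach any y from a small
  ball around 0. The supposed preimage \<open>q0\<close> of 0 is needed as the starting value of
  this process. Compactness controls only finitely many charts upstairs, whose projections cover M.
  Their common expansion factor reaches the other points of a fibre along deck transformations,
  whose linear holonomy commutes with scaling; hence the need to prove that the deck group is
  transitive on fibres. The same radial extension, with a Lebesgue number in place of uniform
  expansion, lifts maps of the unit interval and the unit square through the covering, so one
  argument serves both \<open>p\<close> and \<open>dev\<close>.\<close>

section \<open>Unique lifts and their extension along rays\<close>

text \<open>The property shared by covering maps and developing maps on which uniqueness of lifts
  rests.\<close>

definition locally_inj_on :: "('e \<Rightarrow> 'b) \<Rightarrow> 'e::topological_space set \<Rightarrow> bool" where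
  "locally_inj_on f E \<longleftrightarrow> (\<forall>z\<in>E. \<exists>W. openin (top_of_set E) W \<and> z \<in> W \<and> inj_on f W)"

text \<open>The agreement set is clopen in \<open>S\<close>: open because near an agreement point
  both lifts stay in one set on which \<open>f\<close> is injective, closed because \<open>E\<close>
  is Hausdorff.\<close>

lemma lift_unique:
  fixes g h :: "'a::topological_space \<Rightarrow> 'e::topological_space"
  assumes E: "Hausdorff_space (top_of_set E)" and inj: "locally_inj_on f E"
    and S: "connected S"
    and g: "continuous_on S g" "g \<in> S \<rightarrow> E"
    and h: "continuous_on S h" "h \<in> S \<rightarrow> E"
    and eq: "\<And>x. x \<in> S \<Longrightarrow> f (g x) = f (h x)"
    and a: "a \<in> S" "g a = h a" and x: "x \<in> S"
  shows "g x = h x"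
proof -
  let ?G = "{x \<in> S. g x = h x}"
  have "openin (top_of_set S) ?G"
  proof (subst openin_subopen, clarify)
    fix y assume y: "y \<in> S" "g y = h y"
    then obtain W where W: "openin (top_of_set E) W" "g y \<in> W" "inj_on f W"
      using inj g(2) unfolding locally_inj_on_def by blast
    let ?T = "(S \<inter> g -` W) \<inter> (S \<inter> h -` W)"
    have "openin (top_of_set S) ?T"
      by (intro openin_Int continuous_openin_preimage[OF g W(1)]
          continuous_openin_preimage[OF h W(1)])
    moreover have "?T \<subseteq> ?G"
      using eq W(3) by (auto dest: inj_onD)
    ultimately show "\<exists>T. openin (top_of_set S) T \<and> y \<in> T \<and> T \<subseteq> ?G"
      using y W(2) by (intro exI[of _ ?T]) auto
  qed
  moreover have "closedin (top_of_set S) ?G"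
  proof -
    have "openin (top_of_set S) (S - ?G)"
    proof (subst openin_subopen, intro ballI)
      fix y assume "y \<in> S - ?G"
      then have y: "y \<in> S" "g y \<noteq> h y" by auto
      then have "g y \<in> E" "h y \<in> E" "g y \<noteq> h y"
        using g(2) h(2) by auto
      then obtain U V where UV: "openin (top_of_set E) U" "openin (top_of_set E) V"
          "g y \<in> U" "h y \<in> V" "disjnt U V"
        using E unfolding Hausdorff_space_def by (metis topspace_euclidean_subtopology)
      let ?T = "(S \<inter> g -` U) \<inter> (S \<inter> h -` V)"
      have "openin (top_of_set S) ?T"
        by (intro openin_Int continuous_openin_preimage[OF g UV(1)]
            continuous_openin_preimage[OF h UV(2)])
      moreover have "?T \<subseteq> S - ?G"
        using UV(5) by (auto simp: disjnt_iff)
      ultimately show "\<exists>T. openin (top_of_set S) T \<and> y \<in> T \<and> T \<subseteq> S - ?G"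
        using y UV by (intro exI[of _ ?T]) auto
    qed
    then show ?thesis by (simp add: closedin_def)
  qed
  ultimately have "?G = {} \<or> ?G = S"
    using S connected_clopen by blast
  then show ?thesis using a x by blast
qed

lemma continuous_on_locally_eq:
  assumes "\<And>x. x \<in> S \<Longrightarrow>
    \<exists>N h. openin (top_of_set S) N \<and> x \<in> N \<and> continuous_on N h \<and> (\<forall>y\<in>N. g y = h y)"
  shows "continuous_on S g"
proof (subst continuous_on_open_gen[of _ _ UNIV])
  show "\<forall>U. openin (top_of_set UNIV) U \<longrightarrow> openin (top_of_set S) (S \<inter> g -` U)"
  proof clarify
    fix U :: "'b set" assume U: "openin (top_of_set UNIV) U"
    show "openin (top_of_set S) (S \<inter> g -` U)"
    proof (subst openin_subopen, clarify)
      fix x assume x: "x \<in> S" "g x \<in> U"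
      then obtain N h where N: "openin (top_of_set S) N" "x \<in> N" "continuous_on N h"
          "\<forall>y\<in>N. g y = h y"
        using assms by blast
      have "openin (top_of_set N) (N \<inter> h -` U)"
        using N(3) U by (intro continuous_openin_preimage_gen) auto
      then have "openin (top_of_set S) (N \<inter> h -` U)"
        using N(1) openin_trans by blast
      then show "\<exists>T. openin (top_of_set S) T \<and> x \<in> T \<and> T \<subseteq> S \<inter> g -` U"
        using N x openin_imp_subset by (intro exI[of _ "N \<inter> h -` U"]) fastforce
    qed
  qed
qed auto

text \<open>The value at \<open>y\<close> comes from lifting the segment \<open>[y/c, y]\<close> from the value already known
  at \<open>y/c\<close>.\<close>
lemma radial_lift_step:
  fixes K :: "'a::real_normed_vector set" and \<pi> :: "'e::topological_space \<Rightarrow> 'b"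
  assumes E: "Hausdorff_space (top_of_set E)" and inj: "locally_inj_on \<pi> E"
    and K: "convex K" "0 \<in> K" and c: "1 < c"
    and step: "\<And>y z. \<lbrakk>y \<in> K; z \<in> E; \<pi> z = f (y /\<^sub>R c)\<rbrakk> \<Longrightarrow>
      \<exists>N h. openin (top_of_set K) N \<and> convex N \<and> y \<in> N \<and> y /\<^sub>R c \<in> N \<and>
            continuous_on N h \<and> h \<in> N \<rightarrow> E \<and> (\<forall>x\<in>N. \<pi> (h x) = f x) \<and> h (y /\<^sub>R c) = z"
    and g: "continuous_on (K \<inter> ball 0 r) g" "g \<in> (K \<inter> ball 0 r) \<rightarrow> E"
      "\<And>x. x \<in> K \<inter> ball 0 r \<Longrightarrow> \<pi> (g x) = f x"
  obtains G where "continuous_on (K \<inter> ball 0 (c * r)) G" "G \<in> (K \<inter> ball 0 (c * r)) \<rightarrow> E"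
      "\<And>x. x \<in> K \<inter> ball 0 (c * r) \<Longrightarrow> \<pi> (G x) = f x"
      "\<And>x. x \<in> K \<inter> ball 0 r \<Longrightarrow> G x = g x"
proof -
  let ?B = "K \<inter> ball 0 r" and ?C = "K \<inter> ball 0 (c * r)"
  have shrink: "y /\<^sub>R c \<in> ?B" if "y \<in> ?C" for y
  proof -
    have "(1 - 1/c) *\<^sub>R 0 + (1/c) *\<^sub>R y \<in> K"
      using K that c by (intro convexD) auto
    moreover have "norm y / c < r"
      using that c by (simp add: field_simps)
    ultimately show ?thesis using c by (simp add: divide_inverse_commute)
  qed
  define Q where "Q y N h \<longleftrightarrow> openin (top_of_set K) N \<and> convex N \<and> y \<in> N \<and> y /\<^sub>R c \<in> N \<and>
        continuous_on N h \<and> h \<in> N \<rightarrow> E \<and> (\<forall>x\<in>N. \<pi> (h x) = f x) \<and> h (y /\<^sub>R c) = g (y /\<^sub>R c)"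
    for y N h
  have "\<exists>N h. Q y N h" if "y \<in> ?C" for y
    unfolding Q_def using shrink[OF that] g that by (intro step) auto
  then obtain N h where "\<And>y. y \<in> ?C \<Longrightarrow> Q y (N y) (h y)"
    by metis
  then have N: "\<And>y. y \<in> ?C \<Longrightarrow> openin (top_of_set K) (N y)"
      "\<And>y. y \<in> ?C \<Longrightarrow> convex (N y)" "\<And>y. y \<in> ?C \<Longrightarrow> y \<in> N y" "\<And>y. y \<in> ?C \<Longrightarrow> y /\<^sub>R c \<in> N y"
    and h: "\<And>y. y \<in> ?C \<Longrightarrow> continuous_on (N y) (h y)" "\<And>y. y \<in> ?C \<Longrightarrow> h y \<in> N y \<rightarrow> E"
      "\<And>y x. y \<in> ?C \<Longrightarrow> x \<in> N y \<Longrightarrow> \<pi> (h y x) = f x"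
      "\<And>y. y \<in> ?C \<Longrightarrow> h y (y /\<^sub>R c) = g (y /\<^sub>R c)"
    unfolding Q_def by blast+
  define G where "G y = h y y" for y
  \<comment> \<open>Both functions lift \<open>f\<close> and agree at the anchor
    \<open>y /\<^sub>R c\<close>. The overlap is connected because \<open>N y\<close> is convex,
    which is why \<open>step\<close> asks for convex pieces.\<close>
  have hg: "h y x = g x" if "y \<in> ?C" "x \<in> N y" "x \<in> ?B" for x y
  proof (rule lift_unique[OF E inj, of "N y \<inter> ?B" _ _ "y /\<^sub>R c"])
    show "connected (N y \<inter> ?B)"
      using N(2)[OF that(1)] K by (intro convex_connected convex_Int convex_ball) auto
    show "continuous_on (N y \<inter> ?B) (h y)"
      using h(1)[OF that(1)] by (rule continuous_on_subset) auto
    show "continuous_on (N y \<inter> ?B) g"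
      using g(1) by (rule continuous_on_subset) auto
    show "h y \<in> N y \<inter> ?B \<rightarrow> E" "g \<in> N y \<inter> ?B \<rightarrow> E"
      using h(2)[OF that(1)] g(2) by auto
    show "\<pi> (h y u) = \<pi> (g u)" if "u \<in> N y \<inter> ?B" for u
      using h(3)[OF \<open>y \<in> ?C\<close>, of u] g(3)[of u] that by simp
    show "h y (y /\<^sub>R c) = g (y /\<^sub>R c)"
      using h(4)[OF that(1)] .
    show "y /\<^sub>R c \<in> N y \<inter> ?B"
      using N(4)[OF that(1)] shrink[OF that(1)] by auto
  qed (use that in auto)
  \<comment> \<open>Here the pieces of \<open>y\<close> and \<open>x\<close> are compared at the
    anchor of \<open>x\<close>: there \<open>h x\<close> equals \<open>g\<close> by construction and
    \<open>h y\<close> equals \<open>g\<close> by \<open>hg\<close>.\<close>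
  have hG: "h y x = G x" if "y \<in> ?C" "x \<in> ?C" "x \<in> N y" "x /\<^sub>R c \<in> N y" for x y
    unfolding G_def
  proof (rule lift_unique[OF E inj, of "N y \<inter> N x" "h y" "h x" "x /\<^sub>R c"])
    show "connected (N y \<inter> N x)"
      using N(2) that by (intro convex_connected convex_Int) auto
    show "continuous_on (N y \<inter> N x) (h y)" "continuous_on (N y \<inter> N x) (h x)"
      using h(1)[OF that(1)] h(1)[OF that(2)] by (meson continuous_on_subset inf_le1 inf_le2)+
    show "h y (x /\<^sub>R c) = h x (x /\<^sub>R c)"
      using hg[OF that(1,4) shrink[OF that(2)]] h(4)[OF that(2)] by simp
    show "h y \<in> N y \<inter> N x \<rightarrow> E" "h x \<in> N y \<inter> N x \<rightarrow> E"
      using h(2)[OF that(1)] h(2)[OF that(2)] by auto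
    show "\<pi> (h y u) = \<pi> (h x u)" if "u \<in> N y \<inter> N x" for u
      using h(3)[OF \<open>y \<in> ?C\<close>, of u] h(3)[OF \<open>x \<in> ?C\<close>, of u] that by simp
    show "x /\<^sub>R c \<in> N y \<inter> N x" "x \<in> N y \<inter> N x"
      using N(3,4)[OF that(2)] that by auto
  qed
  show thesis
  proof
    show "continuous_on ?C G"
    proof (rule continuous_on_locally_eq)
      fix y assume y: "y \<in> ?C"
      \<comment> \<open>The points where \<open>hG\<close> applies: both \<open>x\<close> and its
        anchor must lie in \<open>N y\<close>.\<close>
      let ?T = "?C \<inter> N y \<inter> (?C \<inter> (\<lambda>x. x /\<^sub>R c) -` N y)"
      obtain U where U: "open U" "N y = K \<inter> U"
        using N(1)[OF y] openin_open by metis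
      then have "?C \<inter> N y = ?C \<inter> U" by blast
      then have C: "openin (top_of_set ?C) (?C \<inter> N y)"
        using U(1) openin_open_Int by metis
      have "openin (top_of_set ?C) (?C \<inter> (\<lambda>x. x /\<^sub>R c) -` N y)"
        using shrink by (intro continuous_openin_preimage[OF _ _ N(1)[OF y]] continuous_intros) auto
      then have "openin (top_of_set ?C) ?T" using C by blast
      moreover have "continuous_on ?T (h y)"
        using h(1)[OF y] by (rule continuous_on_subset) auto
      moreover have "y \<in> ?T" using N(3,4)[OF y] y by auto
      moreover have "G x = h y x" if "x \<in> ?T" for x
        using hG[OF y, of x] that by simp
      ultimately show "\<exists>N h. openin (top_of_set ?C) N \<and> y \<in> N \<and> continuous_on N h \<and> (\<forall>x\<in>N. G x = h x)"
        by blast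
    qed
    show "G \<in> ?C \<rightarrow> E"
      unfolding G_def using funcset_mem[OF h(2) N(3)] by blast
    show "\<pi> (G x) = f x" if "x \<in> ?C" for x
      unfolding G_def using h(3)[OF that N(3)[OF that]] .
    show "G x = g x" if "x \<in> ?B" for x
    proof -
      \<comment> \<open>Positivity of \<open>r\<close> is not assumed; it follows because the ball
        contains \<open>x\<close>.\<close>
      have "norm x < r" using that by auto
      then have "0 < r" by (metis norm_ge_zero le_less_trans)
      then have "r \<le> c * r" using c by simp
      then have "x \<in> ?C" using that by auto
      then show ?thesis using hg[of x x] N(3)[of x] that unfolding G_def by simp
    qed
  qed
qed

text \<open>Each step multiplies the radius by the same \<open>c > 1\<close>, so the balls of radius
  \<open>c ^ k * r\<close> exhaust \<open>K\<close> even when \<open>K\<close> is the whole space. A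
  factor depending on the point could tend to 1 and stall the extension.\<close>

lemma radial_lift:
  fixes K :: "'a::real_normed_vector set" and \<pi> :: "'e::topological_space \<Rightarrow> 'b"
  assumes E: "Hausdorff_space (top_of_set E)" and inj: "locally_inj_on \<pi> E"
    and K: "convex K" "0 \<in> K" and c: "1 < c"
    and z0: "z0 \<in> E" "\<pi> z0 = f 0"
    and step: "\<And>y z. \<lbrakk>y \<in> K; z \<in> E; \<pi> z = f (y /\<^sub>R c)\<rbrakk> \<Longrightarrow>
      \<exists>N h. openin (top_of_set K) N \<and> convex N \<and> y \<in> N \<and> y /\<^sub>R c \<in> N \<and>
            continuous_on N h \<and> h \<in> N \<rightarrow> E \<and> (\<forall>x\<in>N. \<pi> (h x) = f x) \<and> h (y /\<^sub>R c) = z"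
  obtains g where "continuous_on K g" "g \<in> K \<rightarrow> E" "\<And>x. x \<in> K \<Longrightarrow> \<pi> (g x) = f x" "g 0 = z0"
proof -
  \<comment> \<open>The point 0 is its own anchor, so \<open>step\<close> at \<open>y = 0\<close>
    supplies the initial piece.\<close>
  obtain N0 h0 where N0: "openin (top_of_set K) N0" "0 \<in> N0" "continuous_on N0 h0" "h0 \<in> N0 \<rightarrow> E"
    "\<forall>x\<in>N0. \<pi> (h0 x) = f x" "h0 0 = z0"
    using step[of 0 z0] K z0 by auto
  then obtain r where r: "r > 0" "K \<inter> ball 0 r \<subseteq> N0"
    by (metis inf_commute openin_contains_ball)
  define B where "B k = K \<inter> ball 0 (c ^ k * r)" for k
  define P where "P k g \<longleftrightarrow> continuous_on (B k) g \<and> g \<in> B k \<rightarrow> E \<and> (\<forall>x\<in>B k. \<pi> (g x) = f x) \<and> g 0 = z0" for k g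
  have mono: "B k \<subseteq> B l" if "k \<le> l" for k l
    using c r that unfolding B_def
    by (intro Int_mono subset_ball mult_right_mono power_increasing) auto
  have zB: "0 \<in> B k" for k
    using K r c by (simp add: B_def)
  have "\<exists>g. P k g" for k
  proof (induction k)
    case 0
    have "P 0 h0"
      using N0 r unfolding P_def B_def by (auto intro: continuous_on_subset[OF N0(3)])
    then show ?case by blast
  next
    case (Suc k)
    then obtain g where g: "P k g" by blast
    show ?case
    proof (rule radial_lift_step[OF E inj K c step, of "c ^ k * r" g])
      fix G assume G: "continuous_on (K \<inter> ball 0 (c * (c ^ k * r))) G"
        "G \<in> K \<inter> ball 0 (c * (c ^ k * r)) \<rightarrow> E"
        "\<And>x. x \<in> K \<inter> ball 0 (c * (c ^ k * r)) \<Longrightarrow> \<pi> (G x) = f x"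
        "\<And>x. x \<in> K \<inter> ball 0 (c ^ k * r) \<Longrightarrow> G x = g x"
      have "B (Suc k) = K \<inter> ball 0 (c * (c ^ k * r))"
        by (simp add: B_def mult.assoc)
      then have "P (Suc k) G"
        using G g zB[of k] unfolding P_def by (auto simp: B_def)
      then show ?thesis by blast
    qed (use g in \<open>auto simp: P_def B_def\<close>)
  qed
  then obtain g where g: "\<And>k. P k (g k)" by metis
  \<comment> \<open>The stages \<open>g k\<close> were chosen independently. They are compatible
    because they share the value \<open>z0\<close> at 0 and \<open>B k\<close> is connected.\<close>
  have le: "g k x = g l x" if "k \<le> l" "x \<in> B k" for k l x
  proof (rule lift_unique[OF E inj, of "B k" _ _ 0])
    show "connected (B k)"
      unfolding B_def using K by (intro convex_connected convex_Int convex_ball)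
    show "continuous_on (B k) (g k)" "continuous_on (B k) (g l)"
      using g mono[OF that(1)] unfolding P_def by (blast intro: continuous_on_subset)+
  qed (use g mono[OF that(1)] that zB in \<open>auto simp: P_def\<close>)
  have "\<exists>k. x \<in> B k" if "x \<in> K" for x
  proof -
    obtain k where "norm x / r < c ^ k" using c real_arch_pow by blast
    then show ?thesis using r that by (auto simp: B_def field_simps)
  qed
  then obtain k where k: "\<And>x. x \<in> K \<Longrightarrow> x \<in> B (k x)" by metis
  define G where "G x = g (k x) x" for x
  have G: "G x = g l x" if "x \<in> B l" for x l
    unfolding G_def using le k that by (metis B_def IntD1 nat_le_linear)
  show thesis
  proof
    show "continuous_on K G"
    proof (rule continuous_on_locally_eq)
      fix x assume "x \<in> K"
      then show "\<exists>N h. openin (top_of_set K) N \<and> x \<in> N \<and> continuous_on N h \<and> (\<forall>y\<in>N. G y = h y)"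
        using k[of x] g[of "k x"] G unfolding P_def
        by (intro exI[of _ "B (k x)"] exI[of _ "g (k x)"]) (auto simp: B_def openin_open_Int)
    qed
    show "G \<in> K \<rightarrow> E" "\<And>x. x \<in> K \<Longrightarrow> \<pi> (G x) = f x"
      using k g unfolding P_def G_def by (auto simp: Pi_iff)
    show "G 0 = z0" using g unfolding G_def P_def by blast
  qed
qed


section \<open>Lifting through coverings of Hausdorff spaces\<close>

lemma covering_space_evenly_covered:
  assumes "covering_space C p S" "s \<in> S"
  obtains T where "s \<in> T" "openin (top_of_set S) T"
    "\<And>z. \<lbrakk>z \<in> C; p z \<in> T\<rbrakk> \<Longrightarrow>
      \<exists>u q. openin (top_of_set C) u \<and> z \<in> u \<and> homeomorphism u T p q"
proof -
  obtain T v where T: "s \<in> T" "openin (top_of_set S) T" "\<Union>v = C \<inter> p -` T"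
    "\<forall>u\<in>v. openin (top_of_set C) u" "\<forall>u\<in>v. \<exists>q. homeomorphism u T p q"
    using assms unfolding covering_space_def by meson
  show thesis
  proof (rule that[OF T(1,2)])
    fix z assume "z \<in> C" "p z \<in> T"
    then have "z \<in> \<Union>v" using T(3) by auto
    then show "\<exists>u q. openin (top_of_set C) u \<and> z \<in> u \<and> homeomorphism u T p q"
      using T(4,5) by blast
  qed
qed

lemma covering_space_locally_inj_on:
  assumes "covering_space C p S"
  shows "locally_inj_on p C"
  unfolding locally_inj_on_def
proof
  fix z assume "z \<in> C"
  then obtain T u q where "z \<in> T" "openin (top_of_set C) T" "homeomorphism T u p q"
    using covering_space_local_homeomorphism[OF assms] by metis
  then show "\<exists>W. openin (top_of_set C) W \<and> z \<in> W \<and> inj_on p W"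
    by (metis homeomorphism_apply1 inj_on_inverseI)
qed

text \<open>Points over different base points are separated by preimages of open sets; points of one
  fibre lie in disjoint sheets. This supplies the Hausdorff hypothesis of \<open>lift_unique\<close>
  upstairs.\<close>

lemma covering_space_Hausdorff_space:
  assumes cov: "covering_space C p S" and S: "Hausdorff_space (top_of_set S)"
  shows "Hausdorff_space (top_of_set C)"
  unfolding Hausdorff_space_def
proof (intro allI impI, elim conjE)
  fix x y assume "x \<in> topspace (top_of_set C)" "y \<in> topspace (top_of_set C)" and ne: "x \<noteq> y"
  then have xy: "x \<in> C" "y \<in> C" by auto
  have p: "continuous_on C p" "p \<in> C \<rightarrow> S"
    using cov by (auto simp: covering_space_def)
  show "\<exists>U V. openin (top_of_set C) U \<and> openin (top_of_set C) V \<and> x \<in> U \<and> y \<in> V \<and> disjnt U V"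
  proof (cases "p x = p y")
    case False
    then obtain U V where UV: "openin (top_of_set S) U" "openin (top_of_set S) V"
        "p x \<in> U" "p y \<in> V" "disjnt U V"
      using S p(2) xy unfolding Hausdorff_space_def by (metis PiE topspace_euclidean_subtopology)
    have "openin (top_of_set C) (C \<inter> p -` U)" "openin (top_of_set C) (C \<inter> p -` V)"
      using continuous_openin_preimage[OF p] UV by auto
    moreover have "disjnt (C \<inter> p -` U) (C \<inter> p -` V)"
      using UV(5) by (auto simp: disjnt_iff)
    ultimately show ?thesis using UV xy by blast
  next
    case True
    obtain T v where T: "p x \<in> T" "\<Union>v = C \<inter> p -` T"
      "\<forall>u\<in>v. openin (top_of_set C) u" "pairwise disjnt v" "\<forall>u\<in>v. \<exists>q. homeomorphism u T p q"
      using cov p(2) xy unfolding covering_space_def by (metis PiE)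
    have "x \<in> \<Union>v" "y \<in> \<Union>v" using T(1,2) True xy by auto
    then obtain u1 u2 where u: "u1 \<in> v" "x \<in> u1" "u2 \<in> v" "y \<in> u2" by blast
    have "u1 \<noteq> u2"
      using T(5) u True ne by (metis homeomorphism_apply1)
    then have "disjnt u1 u2" using T(4) u unfolding pairwise_def by simp
    then show ?thesis using T(3) u by blast
  qed
qed

text \<open>A Lebesgue number \<open>\<delta>\<close> makes \<open>f\<close> map each
  \<open>K \<inter> ball y \<delta>\<close> into an evenly covered set, where composing with the
  inverse of a sheet gives a local lift. It remains to choose \<open>c\<close> so close to 1 that
  \<open>y /\<^sub>R c\<close> lies in that ball. The uses are the interval (path lifting) and the
  square (homotopy lifting).\<close>

lemma covering_space_lift_convex:
  fixes K :: "'a::real_normed_vector set"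
  assumes cov: "covering_space C p S" and S: "Hausdorff_space (top_of_set S)"
    and K: "compact K" "convex K" "0 \<in> K"
    and f: "continuous_on K f" "f \<in> K \<rightarrow> S" and z0: "z0 \<in> C" "p z0 = f 0"
  obtains g where "continuous_on K g" "g \<in> K \<rightarrow> C" "\<And>x. x \<in> K \<Longrightarrow> p (g x) = f x" "g 0 = z0"
proof -
  define ev where "ev T \<longleftrightarrow> openin (top_of_set S) T \<and> (\<forall>z\<in>C. p z \<in> T \<longrightarrow>
      (\<exists>u q. openin (top_of_set C) u \<and> z \<in> u \<and> homeomorphism u T p q))" for T
  define \<G> where "\<G> = {U. open U \<and> (\<exists>T. ev T \<and> f ` (K \<inter> U) \<subseteq> T)}"
  have cover: "K \<subseteq> \<Union>\<G>"
  proof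
    fix x assume x: "x \<in> K"
    then have "f x \<in> S" using f by auto
    then obtain T where T: "f x \<in> T" "ev T"
      unfolding ev_def by (metis covering_space_evenly_covered[OF cov])
    then have "openin (top_of_set K) (K \<inter> f -` T)"
      unfolding ev_def using continuous_openin_preimage[OF f] by blast
    then obtain U where U: "open U" "K \<inter> f -` T = K \<inter> U"
      by (auto simp: openin_open)
    then have "f ` (K \<inter> U) \<subseteq> T" by blast
    then have "U \<in> \<G>" using U T by (auto simp: \<G>_def)
    moreover have "x \<in> U" using U T x by blast
    ultimately show "x \<in> \<Union>\<G>" by blast
  qed
  have "open G" if "G \<in> \<G>" for G
    using that by (simp add: \<G>_def)
  then obtain \<delta> where \<delta>: "0 < \<delta>" "\<And>x. x \<in> K \<Longrightarrow> \<exists>G\<in>\<G>. ball x \<delta> \<subseteq> G"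
    using Heine_Borel_lemma[OF K(1) cover] by metis
  obtain R where R: "R > 0" "\<And>x. x \<in> K \<Longrightarrow> norm x \<le> R"
    using compact_imp_bounded[OF K(1)] bounded_pos by metis
  \<comment> \<open>This choice gives \<open>(1 - 1/c) * R = \<delta> / c < \<delta>\<close>, which
    bounds the distance from \<open>y\<close> to \<open>y /\<^sub>R c\<close>.\<close>
  define c where "c = 1 + \<delta> / R"
  have c: "1 < c" using \<delta> R by (simp add: c_def)
  have near: "y /\<^sub>R c \<in> K \<inter> ball y \<delta>" if y: "y \<in> K" for y
  proof -
    have "(1 - 1/c) *\<^sub>R 0 + (1/c) *\<^sub>R y \<in> K"
      using K that c by (intro convexD) auto
    then have "y /\<^sub>R c \<in> K" using c by (simp add: divide_inverse_commute)
    moreover have "dist y (y /\<^sub>R c) < \<delta>"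
    proof -
      have "y - y /\<^sub>R c = (1 - 1/c) *\<^sub>R y" by (simp add: algebra_simps divide_inverse)
      then have "dist y (y /\<^sub>R c) = (1 - 1/c) * norm y"
        using c by (simp add: dist_norm)
      also have "\<dots> \<le> (1 - 1/c) * R"
        using R(2)[OF y] c by (intro mult_left_mono) auto
      also have "\<dots> = \<delta> / c"
        using R c by (simp add: c_def field_simps)
      also have "\<dots> < \<delta>" using \<delta> c by (simp add: field_simps)
      finally show ?thesis .
    qed
    ultimately show ?thesis by simp
  qed
  show thesis
  proof (rule radial_lift[OF covering_space_Hausdorff_space[OF cov S]
        covering_space_locally_inj_on[OF cov] K(2,3) c z0(1), of f])
    fix y z assume y: "y \<in> K" and z: "z \<in> C" "p z = f (y /\<^sub>R c)"
    obtain T where T: "ev T" "f ` (K \<inter> ball y \<delta>) \<subseteq> T"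
      using \<delta>(2)[OF y] unfolding \<G>_def by blast
    then have "p z \<in> T" using near[OF y] z by auto
    then obtain u q where u: "openin (top_of_set C) u" "z \<in> u" "homeomorphism u T p q"
      using T z unfolding ev_def by blast
    have sub: "u \<subseteq> C" using u openin_imp_subset by blast
    have "continuous_on (K \<inter> ball y \<delta>) (q \<circ> f)"
      using T(2) u(3) f(1) unfolding homeomorphism_def
      by (meson continuous_on_compose continuous_on_subset inf_le1)
    moreover have "q \<circ> f \<in> K \<inter> ball y \<delta> \<rightarrow> C" "\<forall>x\<in>K \<inter> ball y \<delta>. p ((q \<circ> f) x) = f x"
    proof -
      have "q (f x) \<in> u \<and> p (q (f x)) = f x" if "x \<in> K \<inter> ball y \<delta>" for x
        using T(2) u(3) that unfolding homeomorphism_def by (metis image_eqI subsetD)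
      then show "q \<circ> f \<in> K \<inter> ball y \<delta> \<rightarrow> C" "\<forall>x\<in>K \<inter> ball y \<delta>. p ((q \<circ> f) x) = f x"
        using sub by auto
    qed
    moreover have "(q \<circ> f) (y /\<^sub>R c) = z"
      using u z by (metis comp_apply homeomorphism_apply1)
    ultimately show "\<exists>N h. openin (top_of_set K) N \<and> convex N \<and> y \<in> N \<and> y /\<^sub>R c \<in> N \<and>
        continuous_on N h \<and> h \<in> N \<rightarrow> C \<and> (\<forall>x\<in>N. p (h x) = f x) \<and> h (y /\<^sub>R c) = z"
      using near[OF y] y \<delta>(1) K(2)
      by (intro exI[of _ "K \<inter> ball y \<delta>"] exI[of _ "q \<circ> f"] conjI)
         (auto intro: convex_Int openin_open_Int)
  qed (use that z0 in auto)
qed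

text \<open>Contract the loop \<open>\<alpha>\<close> in \<open>C\<close>, project the contraction
  by \<open>p\<close>, and lift it again from \<open>\<beta> 0\<close>. The edge over
  \<open>\<alpha>\<close> lifts to \<open>\<beta>\<close> and the opposite edge to a constant;
  comparing the remaining two edges closes \<open>\<beta>\<close>.\<close>

lemma simply_connected_cover_lift_loop:
  assumes cov: "covering_space C p S" and S: "Hausdorff_space (top_of_set S)"
    and C: "simply_connected C"
    and \<alpha>: "path \<alpha>" "path_image \<alpha> \<subseteq> C" "\<alpha> 0 = \<alpha> 1"
    and \<beta>: "path \<beta>" "path_image \<beta> \<subseteq> C" and eq: "\<And>t. t \<in> {0..1} \<Longrightarrow> p (\<alpha> t) = p (\<beta> t)"
  shows "\<beta> 0 = \<beta> 1"
proof -
  note unique = lift_unique[OF covering_space_Hausdorff_space[OF cov S]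
        covering_space_locally_inj_on[OF cov]]
  have \<alpha>0: "\<alpha> 0 \<in> C" using \<alpha>(2) by (auto simp: path_image_def)
  have \<beta>C: "continuous_on {0..1} \<beta>" "\<beta> \<in> {0..1} \<rightarrow> C"
    using \<beta> by (auto simp: path_def path_image_def)
  have p: "continuous_on C p" "p \<in> C \<rightarrow> S"
    using cov by (auto simp: covering_space_def)
  have "homotopic_loops C \<alpha> (\<lambda>t. \<alpha> 0)"
    using C[unfolded simply_connected_def, rule_format, of \<alpha> "\<lambda>t. \<alpha> 0"] \<alpha> \<alpha>0
    by (auto simp: path_def path_image_def pathstart_def pathfinish_def)
  then obtain H where H: "continuous_on ({0..1::real} \<times> {0..1}) H" "H \<in> {0..1} \<times> {0..1} \<rightarrow> C"
    "\<forall>x\<in>{0..1}. H (0, x) = \<alpha> x" "\<forall>x\<in>{0..1}. H (1, x) = \<alpha> 0"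
    "\<forall>t\<in>{0..1}. H (t, 1) = H (t, 0)"
    unfolding homotopic_loops by (auto simp: pathstart_def pathfinish_def)
  have cf: "continuous_on ({0..1} \<times> {0..1}) (p \<circ> H)"
    using H p by (metis continuous_on_compose continuous_on_subset image_subset_iff_funcset)
  obtain G where G: "continuous_on ({0..1} \<times> {0..1}) G" "G \<in> {0..1} \<times> {0..1} \<rightarrow> C"
    "\<And>x. x \<in> {0..1} \<times> {0..1} \<Longrightarrow> p (G x) = (p \<circ> H) x" "G (0::real, 0::real) = \<beta> 0"
  proof (rule covering_space_lift_convex[OF cov S, of "{0..1} \<times> {0..1}" "p \<circ> H" "\<beta> 0"])
    show "p \<circ> H \<in> {0..1} \<times> {0..1} \<rightarrow> S"
      using H p by (auto simp: Pi_iff)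
    show "p (\<beta> 0) = (p \<circ> H) 0"
      using H eq by (simp add: zero_prod_def)
  qed (use \<beta>C cf in \<open>auto simp: zero_prod_def intro: compact_Times convex_Times\<close>)
  have cG: "continuous_on {0..1} (\<lambda>t. G (s, t))" "continuous_on {0..1} (\<lambda>t. G (t, s))"
    if "s \<in> {0..1}" for s
    by (rule continuous_on_compose2[OF G(1)]; use that in \<open>auto intro!: continuous_intros\<close>)+
  have GC: "G (s, t) \<in> C" "p (G (s, t)) = p (H (s, t))" if "s \<in> {0..1}" "t \<in> {0..1}" for s t
    using G(2) G(3)[of "(s, t)"] that by auto
  have funs: "(\<lambda>t. G (s, t)) \<in> {0..1} \<rightarrow> C" "(\<lambda>t. G (t, s)) \<in> {0..1} \<rightarrow> C" if "s \<in> {0..1}" for s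
    using GC that by auto
  have unit: "(0::real) \<in> {0..1}" "(1::real) \<in> {0..1}" "connected {0..1::real}" by auto
  have "G (0, 1) = \<beta> 1"
    by (rule unique[OF unit(3) cG(1)[OF unit(1)] funs(1)[OF unit(1)] \<beta>C _ unit(1) G(4) unit(2)])
       (simp add: GC H(3) eq)
  moreover have G1: "G (1, 1) = G (1, 0)"
    by (rule unique[OF unit(3) cG(1)[OF unit(2)] funs(1)[OF unit(2)] continuous_on_const _ _ unit(1) refl unit(2)])
       (simp_all add: GC H(4))
  \<comment> \<open>The edges \<open>G (t, 0)\<close> and \<open>G (t, 1)\<close> have the same
    projection because \<open>H\<close> runs through loops. They agree at \<open>t = 1\<close> by
    \<open>G1\<close>, hence also at \<open>t = 0\<close>.\<close>
  have "G (0, 1) = G (0, 0)"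
    by (rule unique[OF unit(3) cG(2)[OF unit(2)] funs(2)[OF unit(2)] cG(2)[OF unit(1)] funs(2)[OF unit(1)] _
          unit(2) G1 unit(1)]) (simp add: GC H(5))
  ultimately show ?thesis using G(4) by simp
qed

section \<open>Deck transformations from the fibre product\<close>

text \<open>Path components of pairs avoid choosing paths from a base point: independence of the
  path becomes a statement about components, and inversion becomes exchange of coordinates.\<close>

definition fibre_product :: "'c set \<Rightarrow> ('c \<Rightarrow> 'm) \<Rightarrow> ('c \<times> 'c) set" where
  "fibre_product C p = {(x, y). x \<in> C \<and> y \<in> C \<and> p x = p y}"

lemma path_component_fibre_product_swap:
  assumes "path_component (fibre_product C p) (z, a) (x, y)"
  shows "path_component (fibre_product C p) (a, z) (y, x)"
proof -
  obtain g where g: "path g" "path_image g \<subseteq> fibre_product C p" "g 0 = (z, a)" "g 1 = (x, y)"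
    using assms by (auto simp: path_component_def pathstart_def pathfinish_def)
  have "path (prod.swap \<circ> g)"
    unfolding path_def prod.swap_def comp_def
    using g(1) unfolding path_def by (intro continuous_intros)
  moreover have "path_image (prod.swap \<circ> g) \<subseteq> fibre_product C p"
    using g(2) by (fastforce simp: path_image_def fibre_product_def)
  ultimately show ?thesis
    unfolding path_component_def pathstart_def pathfinish_def using g
    by (intro exI[of _ "prod.swap \<circ> g"]) auto
qed

lemma path_component_fibre_product_pair:
  assumes "path \<alpha>" "path \<beta>" "path_image \<alpha> \<subseteq> C" "path_image \<beta> \<subseteq> C"
    and "\<And>t. t \<in> {0..1} \<Longrightarrow> p (\<alpha> t) = p (\<beta> t)"
  shows "path_component (fibre_product C p) (\<alpha> 0, \<beta> 0) (\<alpha> 1, \<beta> 1)"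
proof -
  have "path (\<lambda>t. (\<alpha> t, \<beta> t))"
    using assms(1,2) unfolding path_def by (intro continuous_intros)
  moreover have "path_image (\<lambda>t. (\<alpha> t, \<beta> t)) \<subseteq> fibre_product C p"
    using assms(3-5) by (auto simp: path_image_def fibre_product_def)
  ultimately show ?thesis
    unfolding path_component_def pathstart_def pathfinish_def
    by (intro exI[of _ "\<lambda>t. (\<alpha> t, \<beta> t)"]) auto
qed

text \<open>A path from \<open>(x, y)\<close> to \<open>(x, y')\<close> is a pair of paths with
  equal projections whose first member is a loop, so the second is a loop too. Simple connectedness
  thus makes the component single-valued.\<close>

lemma path_component_fibre_product_unique:
  assumes cov: "covering_space C p S" and S: "Hausdorff_space (top_of_set S)"
    and C: "simply_connected C"
    and "path_component (fibre_product C p) w (x, y)" "path_component (fibre_product C p) w (x, y')"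
  shows "y = y'"
proof -
  have "path_component (fibre_product C p) (x, y) (x, y')"
    using assms(4,5) path_component_sym path_component_trans by blast
  then obtain g where g: "path g" "path_image g \<subseteq> fibre_product C p" "g 0 = (x, y)" "g 1 = (x, y')"
    by (auto simp: path_component_def pathstart_def pathfinish_def)
  have gE: "g t \<in> fibre_product C p" if "t \<in> {0..1}" for t
    using g(2) that by (auto simp: path_image_def)
  have "(snd \<circ> g) 0 = (snd \<circ> g) 1"
  proof (rule simply_connected_cover_lift_loop[OF cov S C, of "fst \<circ> g"])
    show "path (fst \<circ> g)" "path (snd \<circ> g)"
      using g(1) unfolding path_def comp_def by (auto intro: continuous_on_fst continuous_on_snd)
    show "path_image (fst \<circ> g) \<subseteq> C" "path_image (snd \<circ> g) \<subseteq> C"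
      using gE by (force simp: path_image_def fibre_product_def)+
    show "p ((fst \<circ> g) t) = p ((snd \<circ> g) t)" if "t \<in> {0..1}" for t
      using gE[OF that] by (auto simp: fibre_product_def)
  qed (use g in auto)
  then show ?thesis using g by simp
qed

text \<open>Project a path from \<open>z\<close> to \<open>x\<close> and lift it from
  \<open>a\<close>; the endpoint of the lift is the required \<open>y\<close>.\<close>

lemma path_component_fibre_product_total:
  assumes cov: "covering_space C p S" and S: "Hausdorff_space (top_of_set S)"
    and C: "path_connected C" and z: "z \<in> C" "a \<in> C" "p z = p a" and x: "x \<in> C"
  shows "\<exists>y. path_component (fibre_product C p) (z, a) (x, y)"
proof -
  obtain \<alpha> where \<alpha>: "path \<alpha>" "path_image \<alpha> \<subseteq> C" "\<alpha> 0 = z" "\<alpha> 1 = x"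
    using C z x unfolding path_connected_def pathstart_def pathfinish_def by metis
  have p: "continuous_on C p" "p \<in> C \<rightarrow> S"
    using cov by (auto simp: covering_space_def)
  have cf: "continuous_on {0..1} (p \<circ> \<alpha>)"
    using \<alpha> p unfolding path_def path_image_def by (metis continuous_on_compose continuous_on_subset)
  obtain \<beta> where \<beta>: "continuous_on {0..1} \<beta>" "\<beta> \<in> {0..1} \<rightarrow> C"
    "\<And>x. x \<in> {0..1} \<Longrightarrow> p (\<beta> x) = (p \<circ> \<alpha>) x" "\<beta> (0::real) = a"
    by (rule covering_space_lift_convex[OF cov S, of "{0..1}" "p \<circ> \<alpha>" a])
       (use \<alpha> z p cf in \<open>auto simp: path_image_def Pi_iff image_subset_iff\<close>)
  have "path_component (fibre_product C p) (\<alpha> 0, \<beta> 0) (\<alpha> 1, \<beta> 1)"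
    by (rule path_component_fibre_product_pair)
       (use \<alpha> \<beta> in \<open>auto simp: path_def path_image_def\<close>)
  then show ?thesis using \<alpha> \<beta> by auto
qed

text \<open>The path component of \<open>(z, a)\<close> in the fibre product is the graph of the deck
  transformation taking \<open>z\<close> to \<open>a\<close>.\<close>
lemma fibre_product_graph:
  assumes cov: "covering_space C p S" and S: "Hausdorff_space (top_of_set S)"
    and C: "path_connected C" "simply_connected C" "locally path_connected C"
    and z: "z \<in> C" "a \<in> C" "p z = p a"
  obtains \<gamma> where "continuous_on C \<gamma>"
    "\<And>x. x \<in> C \<Longrightarrow> path_component (fibre_product C p) (z, a) (x, \<gamma> x)"
proof -
  let ?R = "path_component (fibre_product C p)"
  obtain \<gamma> where \<gamma>: "\<And>x. x \<in> C \<Longrightarrow> ?R (z, a) (x, \<gamma> x)"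
    using path_component_fibre_product_total[OF cov S C(1) z] by metis
  have mem: "\<gamma> x \<in> C" "p (\<gamma> x) = p x" if "x \<in> C" for x
    using path_component_mem(2)[OF \<gamma>[OF that]] by (auto simp: fibre_product_def)
  have p: "continuous_on C p" "p \<in> C \<rightarrow> S"
    using cov by (auto simp: covering_space_def)
  have "continuous_on C \<gamma>"
  proof (rule continuous_on_locally_eq)
    fix x assume x: "x \<in> C"
    then have "p x \<in> S" using p by auto
    then obtain T where T: "p x \<in> T" "openin (top_of_set S) T"
      "\<And>z. \<lbrakk>z \<in> C; p z \<in> T\<rbrakk> \<Longrightarrow> \<exists>u q. openin (top_of_set C) u \<and> z \<in> u \<and> homeomorphism u T p q"
      using covering_space_evenly_covered[OF cov] by metis
    obtain v q where v: "openin (top_of_set C) v" "\<gamma> x \<in> v" "homeomorphism v T p q"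
      using T mem[OF x] by metis
    have "openin (top_of_set C) (C \<inter> p -` T)"
      using continuous_openin_preimage[OF p T(2)] .
    \<comment> \<open>Local path connectedness keeps the paths from \<open>x\<close> to nearby
      points over \<open>T\<close>, where the sheet inverse \<open>q\<close> is defined.\<close>
    then obtain U V where U: "openin (top_of_set C) U" "path_connected V" "x \<in> U" "U \<subseteq> V"
      "V \<subseteq> C \<inter> p -` T"
      using C(3) x T(1) unfolding locally_def by (metis IntI vimageI)
    have q: "continuous_on V (q \<circ> p)"
    proof (rule continuous_on_compose)
      show "continuous_on V p"
        using p(1) U(5) by (meson continuous_on_subset le_inf_iff)
      show "continuous_on (p ` V) q"
        using U(5) v(3) continuous_on_subset[of T q "p ` V"] unfolding homeomorphism_def by auto
    qed
    \<comment> \<open>Moving along \<open>\<alpha>\<close> in the first coordinate and along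
      \<open>q \<circ> p \<circ> \<alpha>\<close> in the second stays in the fibre product, so
      \<open>(y, q (p y))\<close> lies in the component of \<open>(z, a)\<close>, which has only one
      point over \<open>y\<close>.\<close>
    have "\<gamma> y = (q \<circ> p) y" if "y \<in> U" for y
    proof -
      have "x \<in> V" "y \<in> V" using U(3,4) that by auto
      then have "path_component V x y"
        using U(2) by (simp add: path_connected_component)
      then obtain \<alpha> where \<alpha>: "path \<alpha>" "path_image \<alpha> \<subseteq> V" "\<alpha> 0 = x" "\<alpha> 1 = y"
        unfolding path_component_def pathstart_def pathfinish_def by (elim exE conjE)
      let ?\<beta> = "q \<circ> p \<circ> \<alpha>"
      have "?R (\<alpha> 0, ?\<beta> 0) (\<alpha> 1, ?\<beta> 1)"
      proof (rule path_component_fibre_product_pair)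
        show "path ?\<beta>"
          using \<alpha> q by (metis continuous_on_subset path_continuous_image)
        show "path_image \<alpha> \<subseteq> C" using \<alpha> U by blast
        have "q ` T \<subseteq> C" using v unfolding homeomorphism_def by (metis openin_imp_subset)
        then show "path_image ?\<beta> \<subseteq> C"
          using \<alpha>(2) U(5) by (fastforce simp: path_image_def)
        show "p (\<alpha> t) = p (?\<beta> t)" if "t \<in> {0..1}" for t
        proof -
          have "\<alpha> t \<in> V" using \<alpha>(2) that by (auto simp: path_image_def)
          then show ?thesis using U(5) v(3) by (auto simp: homeomorphism_def)
        qed
      qed (rule \<alpha>(1))
      moreover have "?\<beta> 0 = \<gamma> x"
        using \<alpha>(3) mem[OF x] v(2,3) by (simp add: homeomorphism_def) metis
      ultimately have "?R (x, \<gamma> x) (y, (q \<circ> p) y)" using \<alpha> by simp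
      then have "?R (z, a) (y, (q \<circ> p) y)"
        using path_component_trans[OF \<gamma>[OF x]] by simp
      moreover have "y \<in> C" using that U by blast
      ultimately show ?thesis
        using path_component_fibre_product_unique[OF cov S C(2) \<gamma>, of y "(q \<circ> p) y"] by simp
    qed
    moreover have "continuous_on U (q \<circ> p)"
      using q U(4) by (rule continuous_on_subset)
    ultimately show "\<exists>N h. openin (top_of_set C) N \<and> x \<in> N \<and> continuous_on N h \<and> (\<forall>y\<in>N. \<gamma> y = h y)"
      using U(1,3) by blast
  qed
  then show thesis using \<gamma> that by blast
qed

text \<open>The graphs through \<open>(z, a)\<close> and \<open>(a, z)\<close> are exchanged by the
  coordinate swap, so uniqueness makes the two maps inverse to each other.\<close>

lemma deck_transformation_transitive:
  assumes cov: "covering_space C p S" and S: "Hausdorff_space (top_of_set S)"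
    and C: "path_connected C" "simply_connected C" "locally path_connected C"
    and z: "z \<in> C" "a \<in> C" "p z = p a"
  obtains \<gamma> where "deck_transformation C p \<gamma>" "\<gamma> z = a"
proof -
  let ?R = "path_component (fibre_product C p)"
  note uniq = path_component_fibre_product_unique[OF cov S C(2)]
  note swap = path_component_fibre_product_swap
  obtain \<gamma> where \<gamma>: "continuous_on C \<gamma>" "\<And>x. x \<in> C \<Longrightarrow> ?R (z, a) (x, \<gamma> x)"
    using fibre_product_graph[OF cov S C z] by blast
  obtain \<gamma>' where \<gamma>': "continuous_on C \<gamma>'" "\<And>x. x \<in> C \<Longrightarrow> ?R (a, z) (x, \<gamma>' x)"
    using fibre_product_graph[OF cov S C z(2,1) z(3)[symmetric]] by blast
  have mem: "\<gamma> x \<in> C" "p (\<gamma> x) = p x" "\<gamma>' x \<in> C" if "x \<in> C" for x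
    using path_component_mem(2)[OF \<gamma>(2)[OF that]] path_component_mem(2)[OF \<gamma>'(2)[OF that]]
    by (auto simp: fibre_product_def)
  have inv: "\<gamma>' (\<gamma> x) = x" "\<gamma> (\<gamma>' x) = x" if "x \<in> C" for x
    using uniq[OF \<gamma>'(2)[OF mem(1)[OF that]] swap[OF \<gamma>(2)[OF that]]]
      uniq[OF \<gamma>(2)[OF mem(3)[OF that]] swap[OF \<gamma>'(2)[OF that]]] by auto
  have "homeomorphism C C \<gamma> \<gamma>'"
    by (rule homeomorphismI) (use \<gamma>(1) \<gamma>'(1) mem inv in auto)
  then have "deck_transformation C p \<gamma>"
    unfolding deck_transformation_def using mem by blast
  moreover have "\<gamma> z = a"
  proof (rule uniq[OF \<gamma>(2)[OF z(1)]])
    show "?R (z, a) (z, a)"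
      using z by (intro path_component_refl) (auto simp: fibre_product_def)
  qed
  ultimately show thesis by (rule that)
qed


section \<open>Local structure of the developing map\<close>

lemma covering_space_open_image:
  assumes cov: "covering_space C p S" and V: "openin (top_of_set C) V"
  shows "openin (top_of_set S) (p ` V)"
proof (subst openin_subopen, intro ballI)
  fix y assume "y \<in> p ` V"
  then obtain x where x: "x \<in> V" "y = p x" by blast
  then have "x \<in> C" using V openin_imp_subset by blast
  then obtain T u q where T: "x \<in> T" "openin (top_of_set C) T" "openin (top_of_set S) u"
    "homeomorphism T u p q"
    using covering_space_local_homeomorphism[OF cov] by metis
  have "openin (top_of_set T) (T \<inter> V)"
    using V T(2) by (metis inf_le1 openin_Int openin_imp_subset openin_subset_trans)
  then have "openin (top_of_set u) (p ` (T \<inter> V))"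
    using homeomorphism_imp_open_map[OF T(4)] by blast
  then have "openin (top_of_set S) (p ` (T \<inter> V))"
    using T(3) openin_trans by blast
  then show "\<exists>U. openin (top_of_set S) U \<and> y \<in> U \<and> U \<subseteq> p ` V"
    using x T(1) by (intro exI[of _ "p ` (T \<inter> V)"]) auto
qed

lemma linear_bij_homeomorphism:
  fixes L :: "real^'n \<Rightarrow> real^'n"
  assumes "linear L" "bij L"
  shows "homeomorphism UNIV UNIV L (inv L)"
proof -
  have inv: "inv L y = x" if "L x = y" for x y
    using inv_f_eq[OF bij_is_inj[OF assms(2)] that] .
  have L: "L (inv L y) = y" for y
    using surj_f_inv_f[OF bij_is_surj[OF assms(2)]] .
  have "linear (inv L)"
    by (intro linearI inv) (simp_all add: L linear_add[OF assms(1)] linear_scale[OF assms(1)])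
  then show ?thesis
    using assms(1) by (intro homeomorphismI linear_continuous_on)
      (auto simp: linear_conv_bounded_linear L intro: inv)
qed

lemma affine_aut_homeomorphism:
  assumes "affine_aut T"
  obtains T' where "homeomorphism UNIV UNIV T T'"
proof -
  obtain L b where L: "linear L" "bij L" "T = (\<lambda>x. L x + b)"
    using assms unfolding affine_aut_def by blast
  have "homeomorphism UNIV UNIV (\<lambda>x. x + b) (\<lambda>x. x - b)"
    by (rule homeomorphismI) (auto intro!: continuous_intros)
  then have "homeomorphism UNIV UNIV ((\<lambda>x. x + b) \<circ> L) (inv L \<circ> (\<lambda>x. x - b))"
    using homeomorphism_compose[OF linear_bij_homeomorphism[OF L(1,2)]] by blast
  then show thesis using that L(3) by (simp add: comp_def)
qed

text \<open>Near \<open>z\<close> the map \<open>dev\<close> is the composite of the homeomorphisms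
  \<open>p\<close>, \<open>\<phi>\<close> and \<open>T\<close> between open sets. The image is cut
  down to a ball because convexity is needed for the expansion, and \<open>W\<close> fits into any
  prescribed \<open>V\<close> to give local path connectedness.\<close>

lemma developing_map_chart:
  fixes A :: "('m::topological_space set \<times> ('m \<Rightarrow> real^'n)) set"
  assumes M: "affine_atlas M A" and cov: "covering_space Mt p M"
    and dev: "developing_map Mt p A dev" and V: "openin (top_of_set Mt) V" "z \<in> V"
  obtains W h r where "r > 0" "openin (top_of_set Mt) W" "z \<in> W" "W \<subseteq> V"
    "homeomorphism W (ball (dev z) r) dev h"
proof -
  have z: "z \<in> Mt" using V openin_imp_subset by blast
  obtain W0 U \<phi> T where W0: "z \<in> W0" "openin (top_of_set Mt) W0" "(U, \<phi>) \<in> A" "p ` W0 \<subseteq> U"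
    "affine_aut T" "\<forall>y\<in>W0. dev y = T (\<phi> (p y))"
    using dev z unfolding developing_map_def by metis
  obtain N u q where N: "z \<in> N" "openin (top_of_set Mt) N" "openin (top_of_set M) u"
    "homeomorphism N u p q"
    using covering_space_local_homeomorphism[OF cov z] by metis
  obtain \<phi>' where \<phi>: "openin (top_of_set M) U" "open (\<phi> ` U)" "homeomorphism U (\<phi> ` U) \<phi> \<phi>'"
    using M W0(3) unfolding affine_atlas_def by fast
  obtain T' where T: "homeomorphism UNIV UNIV T T'"
    using affine_aut_homeomorphism[OF W0(5)] by blast
  define W1 where "W1 = W0 \<inter> N \<inter> V"
  have W1: "openin (top_of_set Mt) W1" "z \<in> W1"
    using W0 N V by (auto simp: W1_def)
  have "openin (top_of_set M) (p ` W1)"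
    using covering_space_open_image[OF cov W1(1)] .
  moreover have pU: "p ` W1 \<subseteq> U" using W0 by (auto simp: W1_def)
  ultimately have "openin (top_of_set U) (p ` W1)"
    using \<phi>(1) openin_imp_subset openin_subset_trans by metis
  then have "openin (top_of_set (\<phi> ` U)) (\<phi> ` p ` W1)"
    by (rule homeomorphism_imp_open_map[OF \<phi>(3)])
  then have "open (\<phi> ` p ` W1)"
    using \<phi>(2) openin_open_eq by blast
  then have "openin (top_of_set UNIV) (T ` \<phi> ` p ` W1)"
    using homeomorphism_imp_open_map[OF T, of "\<phi> ` p ` W1"] by simp
  then have op: "open (T ` \<phi> ` p ` W1)" by simp
  have h1: "homeomorphism W1 (p ` W1) p q"
    by (rule homeomorphism_of_subsets[OF N(4)]) (auto simp: W1_def)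
  have h2: "homeomorphism (p ` W1) (\<phi> ` p ` W1) \<phi> \<phi>'"
    by (rule homeomorphism_of_subsets[OF \<phi>(3)]) (use pU in auto)
  have h3: "homeomorphism (\<phi> ` p ` W1) (T ` \<phi> ` p ` W1) T T'"
    by (rule homeomorphism_of_subsets[OF T]) auto
  have dT: "dev y = T (\<phi> (p y))" if "y \<in> W1" for y
    using W0(6) that by (auto simp: W1_def)
  define h where "h = q \<circ> \<phi>' \<circ> T'"
  have hom: "homeomorphism W1 (T ` \<phi> ` p ` W1) dev h"
    by (rule homeomorphism_cong[OF homeomorphism_compose[OF homeomorphism_compose[OF h1 h2] h3]])
      (simp_all add: dT h_def)
  have "dev z \<in> T ` \<phi> ` p ` W1" using dT W1(2) by auto
  then obtain r where r: "r > 0" "ball (dev z) r \<subseteq> T ` \<phi> ` p ` W1"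
    using op open_contains_ball by blast
  define W where "W = h ` ball (dev z) r"
  have hom': "homeomorphism (T ` \<phi> ` p ` W1) W1 h dev"
    using hom homeomorphism_symD by blast
  have homW: "homeomorphism (ball (dev z) r) W h dev"
    by (rule homeomorphism_of_subsets[OF hom' r(2) order_refl]) (simp add: W_def)
  have "openin (top_of_set (T ` \<phi> ` p ` W1)) (ball (dev z) r)"
    using r(2) by (simp add: open_subset)
  then have "openin (top_of_set W1) W"
    unfolding W_def by (rule homeomorphism_imp_open_map[OF hom'])
  then have "openin (top_of_set Mt) W"
    using W1(1) openin_trans by blast
  moreover have "W \<subseteq> V"
    using openin_imp_subset[OF \<open>openin (top_of_set W1) W\<close>] by (auto simp: W1_def)
  moreover have "z \<in> W"
    unfolding W_def using homeomorphism_apply1[OF hom W1(2)] r(1) by (metis centre_in_ball image_eqI)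
  ultimately show thesis
    using that[OF r(1)] homW homeomorphism_symD by blast
qed

lemma developing_map_continuous_on:
  fixes A :: "('m::topological_space set \<times> ('m \<Rightarrow> real^'n)) set"
  assumes "affine_atlas M A" "covering_space Mt p M" "developing_map Mt p A dev"
  shows "continuous_on Mt dev"
proof (rule continuous_on_locally_eq)
  fix z assume "z \<in> Mt"
  then obtain W h r where "openin (top_of_set Mt) W" "z \<in> W" "homeomorphism W (ball (dev z) r) dev h"
    using developing_map_chart[OF assms openin_subtopology_self] by metis
  then show "\<exists>N h. openin (top_of_set Mt) N \<and> z \<in> N \<and> continuous_on N h \<and> (\<forall>y\<in>N. dev y = h y)"
    unfolding homeomorphism_def by (intro exI[of _ W] exI[of _ dev]) simp
qed

lemma developing_map_locally_inj_on:
  fixes A :: "('m::topological_space set \<times> ('m \<Rightarrow> real^'n)) set"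
  assumes "affine_atlas M A" "covering_space Mt p M" "developing_map Mt p A dev"
  shows "locally_inj_on dev Mt"
  unfolding locally_inj_on_def
proof
  fix z assume "z \<in> Mt"
  then obtain W h r where "openin (top_of_set Mt) W" "z \<in> W" "homeomorphism W (ball (dev z) r) dev h"
    using developing_map_chart[OF assms openin_subtopology_self] by metis
  then show "\<exists>W. openin (top_of_set Mt) W \<and> z \<in> W \<and> inj_on dev W"
    by (metis homeomorphism_apply1 inj_on_inverseI)
qed

lemma developing_map_locally_path_connected:
  fixes A :: "('m::topological_space set \<times> ('m \<Rightarrow> real^'n)) set"
  assumes "affine_atlas M A" "covering_space Mt p M" "developing_map Mt p A dev"
  shows "locally path_connected Mt"
proof (rule locallyI)
  fix V z assume "openin (top_of_set Mt) V" "z \<in> V"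
  then obtain W h r where W: "openin (top_of_set Mt) W" "z \<in> W" "W \<subseteq> V"
    "homeomorphism W (ball (dev z) r) dev h"
    using developing_map_chart[OF assms] by metis
  have "path_connected (h ` ball (dev z) r)"
    using W(4) unfolding homeomorphism_def
    by (intro path_connected_continuous_image convex_imp_path_connected convex_ball) auto
  then have "path_connected W" using W(4) by (simp add: homeomorphism_def)
  then show "\<exists>U v. openin (top_of_set Mt) U \<and> path_connected v \<and> z \<in> U \<and> U \<subseteq> v \<and> v \<subseteq> V"
    using W(1-3) by (intro exI[of _ W]) simp
qed

section \<open>Radial expansion\<close>

text \<open>A local inverse \<open>h\<close> of \<open>d\<close> at \<open>z\<close> is defined along the whole segment from \<open>d z\<close> to
  \<open>c *\<^sub>R d z\<close>. This discrete form of the radial flow is invariant under deck transformations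
  when the holonomy is linear.\<close>
definition expandable :: "'c::topological_space set \<Rightarrow> ('c \<Rightarrow> real^'n) \<Rightarrow> real \<Rightarrow> 'c \<Rightarrow> bool" where
  "expandable Mt d c z \<longleftrightarrow> (\<exists>W D h. openin (top_of_set Mt) W \<and> z \<in> W \<and> open D \<and> convex D \<and>
     homeomorphism W D d h \<and> c *\<^sub>R d z \<in> D)"

text \<open>This is where radiance enters: a linear \<open>L\<close> commutes with multiplication by
  \<open>c\<close> and preserves convexity, so moving the chart by \<open>\<gamma>\<close> keeps the
  same factor.\<close>

lemma expandable_deck:
  fixes d :: "'c::topological_space \<Rightarrow> real^'n"
  assumes \<gamma>: "deck_transformation Mt p \<gamma>" and L: "linear L" "bij L" "\<forall>y\<in>Mt. d (\<gamma> y) = L (d y)"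
    and z: "expandable Mt d c z"
  shows "expandable Mt d c (\<gamma> z)"
proof -
  obtain W D h where W: "openin (top_of_set Mt) W" "z \<in> W" "open D" "convex D"
     "homeomorphism W D d h" "c *\<^sub>R d z \<in> D"
    using z unfolding expandable_def by blast
  obtain \<gamma>' where \<gamma>': "homeomorphism Mt Mt \<gamma> \<gamma>'"
    using \<gamma> unfolding deck_transformation_def by blast
  have WM: "W \<subseteq> Mt" using W openin_imp_subset by blast
  have Lh: "homeomorphism UNIV UNIV L (inv L)"
    using linear_bij_homeomorphism L by blast
  have "homeomorphism W (\<gamma> ` W) \<gamma> \<gamma>'"
    by (rule homeomorphism_of_subsets[OF \<gamma>' WM order_refl refl])
  then have h1: "homeomorphism (\<gamma> ` W) W \<gamma>' \<gamma>" by (rule homeomorphism_symD)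
  have h2: "homeomorphism D (L ` D) L (inv L)"
    by (rule homeomorphism_of_subsets[OF Lh]) auto
  have "L (d (\<gamma>' w)) = d w" if "w \<in> \<gamma> ` W" for w
    using that WM \<gamma>' L(3) by (auto simp: homeomorphism_def)
  then have "homeomorphism (\<gamma> ` W) (L ` D) d (\<gamma> \<circ> h \<circ> inv L)"
    by (intro homeomorphism_cong[OF homeomorphism_compose[OF homeomorphism_compose[OF h1 W(5)] h2]])
      simp_all
  moreover have "openin (top_of_set Mt) (\<gamma> ` W)"
    using homeomorphism_imp_open_map[OF \<gamma>' W(1)] .
  moreover have "open (L ` D)"
    using homeomorphism_imp_open_map[OF Lh, of D] W(3) by simp
  moreover have "convex (L ` D)"
    using W(4) L(1) by (rule convex_linear_image[rotated])
  moreover have "c *\<^sub>R d (\<gamma> z) = L (c *\<^sub>R d z)"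
    using L W(2) WM by (metis linear_scale subsetD)
  ultimately show ?thesis
    unfolding expandable_def using W(2,6)
    by (intro exI[of _ "\<gamma> ` W"] exI[of _ "L ` D"] exI[of _ "\<gamma> \<circ> h \<circ> inv L"]) auto
qed

text \<open>Admitting every smaller factor \<open>e > 1\<close> on all of \<open>V\<close> is what
  later allows a minimum over finitely many neighbourhoods.\<close>

lemma expandable_locally:
  fixes A :: "('m::topological_space set \<times> ('m \<Rightarrow> real^'n)) set"
  assumes M: "affine_atlas M A" "covering_space Mt p M" "developing_map Mt p A d"
    and z: "z \<in> Mt"
  shows "\<exists>c V. 1 < c \<and> openin (top_of_set Mt) V \<and> z \<in> V \<and>
    (\<forall>v\<in>V. \<forall>e. 1 < e \<and> e \<le> c \<longrightarrow> expandable Mt d e v)"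
proof -
  obtain W h r where W: "r > 0" "openin (top_of_set Mt) W" "z \<in> W"
    "homeomorphism W (ball (d z) r) d h"
    using developing_map_chart[OF M openin_subtopology_self z] by metis
  \<comment> \<open>Multiplication by \<open>c\<close> moves \<open>d z\<close> by at most
    \<open>r / 2\<close>; the added 1 keeps the denominator positive when
    \<open>d z = 0\<close>.\<close>
  define c where "c = 1 + r / (2 * (norm (d z) + 1))"
  have pos: "0 < norm (d z) + 1" by (simp add: add_nonneg_pos)
  have c: "1 < c" using W(1) pos by (simp add: c_def)
  have "d z - c *\<^sub>R d z = (1 - c) *\<^sub>R d z" by (simp add: algebra_simps)
  then have "dist (d z) (c *\<^sub>R d z) = (c - 1) * norm (d z)"
    using c by (simp add: dist_norm)
  also have "\<dots> \<le> (c - 1) * (norm (d z) + 1)" using c by simp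
  also have "\<dots> = r / 2" using pos by (simp add: c_def field_simps)
  also have "\<dots> < r" using W(1) by simp
  finally have cz: "c *\<^sub>R d z \<in> ball (d z) r" by simp
  define V where "V = W \<inter> (\<lambda>v. c *\<^sub>R d v) -` ball (d z) r"
  have "openin (top_of_set W) V"
    unfolding V_def using W(4) unfolding homeomorphism_def
    by (intro continuous_openin_preimage_gen continuous_intros open_ball) auto
  then have "openin (top_of_set Mt) V" using W(2) openin_trans by blast
  moreover have "z \<in> V" using cz W(3) by (simp add: V_def)
  moreover have "expandable Mt d e v" if v: "v \<in> V" and e: "1 < e" "e \<le> c" for v e
  proof -
    \<comment> \<open>The weight that places \<open>e *\<^sub>R d v\<close> on the segment from
      \<open>d v\<close> to \<open>c *\<^sub>R d v\<close>, both of whose ends lie in the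
      ball.\<close>
    define u where "u = (e - 1) / (c - 1)"
    have u: "0 \<le> u" "u \<le> 1" using e c by (auto simp: u_def)
    have "(1 - u) + u * c = 1 + u * (c - 1)" by (simp add: algebra_simps)
    also have "\<dots> = e" using c by (simp add: u_def)
    finally have "(1 - u) *\<^sub>R d v + u *\<^sub>R (c *\<^sub>R d v) = e *\<^sub>R d v"
      by (simp add: scaleR_add_left[symmetric])
    moreover have "d v \<in> ball (d z) r" "c *\<^sub>R d v \<in> ball (d z) r"
      using v W(4) by (auto simp: V_def homeomorphism_def)
    then have "(1 - u) *\<^sub>R d v + u *\<^sub>R (c *\<^sub>R d v) \<in> ball (d z) r"
      using u by (intro convexD[OF convex_ball]) auto
    ultimately have "e *\<^sub>R d v \<in> ball (d z) r" by simp
    then show ?thesis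
      unfolding expandable_def using W(2,4) v
      by (intro exI[of _ W] exI[of _ "ball (d z) r"] exI[of _ h]) (auto simp: V_def)
  qed
  ultimately show ?thesis using c by blast
qed

section \<open>Closed manifolds with linear holonomy\<close>

context
  fixes M :: "'m::t2_space set"
    and A :: "('m set \<times> ('m \<Rightarrow> real^'n)) set"
    and Mt :: "'c::topological_space set"
    and p :: "'c \<Rightarrow> 'm"
    and d :: "'c \<Rightarrow> real^'n"
  assumes M: "closed_affine_manifold M A"
    and cover: "universal_cover Mt p M"
    and dev: "developing_map Mt p A d"
    and equiv: "\<And>\<gamma>. deck_transformation Mt p \<gamma> \<Longrightarrow>
      \<exists>L. linear L \<and> bij L \<and> (\<forall>y\<in>Mt. d (\<gamma> y) = L (d y))"
begin

lemma cover_facts: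
  "compact M" "affine_atlas M A" "covering_space Mt p M" "path_connected Mt"
  "simply_connected Mt" "locally path_connected Mt" "Hausdorff_space (top_of_set M)"
  "Hausdorff_space (top_of_set Mt)"
proof -
  show 1: "compact M" "affine_atlas M A" "covering_space Mt p M" "path_connected Mt"
    "simply_connected Mt"
    using M cover by (auto simp: closed_affine_manifold_def universal_cover_def)
  show "locally path_connected Mt"
    using developing_map_locally_path_connected[OF 1(2,3) dev] .
  show 2: "Hausdorff_space (top_of_set M)"
    by (intro Hausdorff_space_subtopology)
      (simp add: Hausdorff_space_def disjnt_def, metis hausdorff)
  show "Hausdorff_space (top_of_set Mt)"
    by (rule covering_space_Hausdorff_space[OF 1(3) 2])
qed

lemma deck_transitive:
  assumes "z \<in> Mt" "a \<in> Mt" "p z = p a"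
  obtains \<gamma> where "deck_transformation Mt p \<gamma>" "\<gamma> z = a"
  using deck_transformation_transitive[OF cover_facts(3,7,4,5,6) assms] .

lemma uniformly_expandable:
  obtains c where "1 < c" "\<And>z. z \<in> Mt \<Longrightarrow> expandable Mt d c z"
proof -
  define Q where "Q z c V \<longleftrightarrow> 1 < c \<and> openin (top_of_set Mt) V \<and> z \<in> V \<and>
    (\<forall>v\<in>V. \<forall>e. 1 < e \<and> e \<le> c \<longrightarrow> expandable Mt d e v)" for z c V
  have "\<exists>c V. Q z c V" if "z \<in> Mt" for z
    unfolding Q_def using expandable_locally[OF cover_facts(2,3) dev that] .
  then obtain c V where Q: "\<And>z. z \<in> Mt \<Longrightarrow> Q z (c z) (V z)" by metis
  define \<C> where "\<C> = (\<lambda>z. p ` V z) ` Mt"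
  have "\<forall>C\<in>\<C>. openin (top_of_set M) C"
    using Q covering_space_open_image[OF cover_facts(3)] by (auto simp: \<C>_def Q_def)
  moreover have "M \<subseteq> \<Union>\<C>"
  proof
    fix m assume "m \<in> M"
    then obtain z where "z \<in> Mt" "m = p z"
      using covering_space_imp_surjective[OF cover_facts(3)] by blast
    then show "m \<in> \<Union>\<C>" using Q[of z] by (auto simp: \<C>_def Q_def)
  qed
  ultimately have "\<exists>D\<subseteq>\<C>. finite D \<and> M \<subseteq> \<Union>D"
    using cover_facts(1) unfolding compact_eq_openin_cover by simp
  then obtain F where F: "finite F" "F \<subseteq> Mt" "M \<subseteq> (\<Union>z\<in>F. p ` V z)"
    unfolding \<C>_def by (metis finite_subset_image)
  \<comment> \<open>The 2 keeps the minimum defined and above 1 when \<open>F\<close> is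
    empty.\<close>
  define e where "e = Min (insert 2 (c ` F))"
  have e: "1 < e" "\<And>z. z \<in> F \<Longrightarrow> e \<le> c z"
    using F Q by (auto simp: e_def Q_def)
  show thesis
  proof (rule that[OF e(1)])
    fix z assume z: "z \<in> Mt"
    then have "p z \<in> M" using covering_space_imp_surjective[OF cover_facts(3)] by blast
    then obtain w v where w: "w \<in> F" "v \<in> V w" "p z = p v" using F(3) by blast
    have Qw: "Q w (c w) (V w)" using Q F(2) w(1) by blast
    then have v: "v \<in> Mt" using w(2) openin_imp_subset unfolding Q_def by blast
    have ex: "expandable Mt d e v" using Qw w(1,2) e unfolding Q_def by blast
    obtain \<gamma> where \<gamma>: "deck_transformation Mt p \<gamma>" "\<gamma> v = z"
      using deck_transitive[OF v z] w(3) by metis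
    obtain L where "linear L" "bij L" "\<forall>y\<in>Mt. d (\<gamma> y) = L (d y)"
      using equiv[OF \<gamma>(1)] by blast
    then show "expandable Mt d e z"
      using expandable_deck[OF \<gamma>(1) _ _ _ ex] \<gamma>(2) by blast
  qed
qed

text \<open>A section of \<open>d\<close> is a lift of the identity of \<open>real^'n\<close>. For
  \<open>d z = y /\<^sub>R c\<close>, expandability at \<open>z\<close> puts both
  \<open>y /\<^sub>R c\<close> and \<open>y\<close> into one convex \<open>D\<close> carrying a
  local inverse.\<close>

lemma section_of_developing_map:
  assumes "q0 \<in> Mt" "d q0 = 0"
  obtains g where "continuous_on UNIV g" "g \<in> UNIV \<rightarrow> Mt" "\<And>x. d (g x) = x" "g 0 = q0"
proof -
  obtain c where c: "1 < c" "\<And>z. z \<in> Mt \<Longrightarrow> expandable Mt d c z"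
    using uniformly_expandable by blast
  show thesis
  proof (rule radial_lift[OF cover_facts(8) developing_map_locally_inj_on[OF cover_facts(2,3) dev]
        convex_UNIV UNIV_I c(1) assms(1), of "\<lambda>x. x"])
    fix y z assume z: "z \<in> Mt" "d z = y /\<^sub>R c"
    obtain W D h where W: "openin (top_of_set Mt) W" "z \<in> W" "open D" "convex D"
     "homeomorphism W D d h" "c *\<^sub>R d z \<in> D"
      using c(2)[OF z(1)] unfolding expandable_def by blast
    have "y \<in> D" using W(6) z(2) c(1) by simp
    moreover have "y /\<^sub>R c \<in> D" "h (y /\<^sub>R c) = z"
      using W(2,5) z(2) unfolding homeomorphism_def by (metis image_eqI)+
    moreover have "h \<in> D \<rightarrow> Mt"
      using W(1,5) openin_imp_subset unfolding homeomorphism_def by blast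
    ultimately show "\<exists>N h. openin (top_of_set UNIV) N \<and> convex N \<and> y \<in> N \<and> y /\<^sub>R c \<in> N \<and>
       continuous_on N h \<and> h \<in> N \<rightarrow> Mt \<and> (\<forall>x\<in>N. d (h x) = x) \<and> h (y /\<^sub>R c) = z"
      using W(3,4,5) unfolding homeomorphism_def by (intro exI[of _ D] exI[of _ h]) simp
  qed (use assms that in auto)
qed

lemma zero_notin_developing_image: "0 \<notin> d ` Mt"
proof
  assume "0 \<in> d ` Mt"
  then obtain q0 where q0: "q0 \<in> Mt" "d q0 = 0" by fastforce
  obtain g where g: "continuous_on UNIV g" "g \<in> UNIV \<rightarrow> Mt" "\<And>x. d (g x) = x" "g 0 = q0"
    using section_of_developing_map[OF q0] by blast
  have conn: "connected Mt" using cover_facts(4) path_connected_imp_connected by blast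
  have contd: "continuous_on Mt d"
    using developing_map_continuous_on[OF cover_facts(2,3) dev] .
  have gd: "g (d z) = z" if "z \<in> Mt" for z
  proof (rule lift_unique[OF cover_facts(8) developing_map_locally_inj_on[OF cover_facts(2,3) dev]
        conn, of "\<lambda>z. g (d z)" "\<lambda>z. z" q0])
    show "continuous_on Mt (\<lambda>z. g (d z))"
      using continuous_on_compose2[OF g(1) contd] by simp
  qed (use g q0 that in auto)
  have inj: "inj_on p Mt"
  proof (rule inj_onI)
    fix z a assume z: "z \<in> Mt" "a \<in> Mt" "p z = p a"
    obtain \<gamma> where \<gamma>: "deck_transformation Mt p \<gamma>" "\<gamma> z = a"
      using deck_transitive[OF z] by blast
    then obtain \<gamma>' where hom: "homeomorphism Mt Mt \<gamma> \<gamma>'" and p\<gamma>: "\<And>y. y \<in> Mt \<Longrightarrow> p (\<gamma> y) = p y"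
      unfolding deck_transformation_def by blast
    then have c\<gamma>: "continuous_on Mt \<gamma>" "\<gamma> \<in> Mt \<rightarrow> Mt"
      unfolding homeomorphism_def by auto
    obtain L where L: "linear L" "\<forall>y\<in>Mt. d (\<gamma> y) = L (d y)"
      using equiv[OF \<gamma>(1)] by blast
    \<comment> \<open>By \<open>gd\<close> the map \<open>d\<close> is injective on
      \<open>Mt\<close>, and a linear equivariance sends 0 to 0, so \<open>\<gamma>\<close> fixes
      \<open>q0\<close>. As lifts of \<open>p\<close>, both \<open>\<gamma>\<close> and the identity
      then coincide everywhere.\<close>
    then have "d (\<gamma> q0) = 0" using q0 linear_0[OF L(1)] by simp
    then have "\<gamma> q0 = q0" using gd[OF funcset_mem[OF c\<gamma>(2) q0(1)]] g(4) by simp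
    then have "\<gamma> z = z"
      using lift_unique[OF cover_facts(8) covering_space_locally_inj_on[OF cover_facts(3)] conn c\<gamma>,
          of "\<lambda>z. z" q0 z] p\<gamma> q0(1) z(1) by simp
    then show "z = a" using \<gamma>(2) by simp
  qed
  obtain q where "homeomorphism Mt M p q"
    using homeomorphism_injective_open_map[OF covering_space_imp_continuous[OF cover_facts(3)]
        covering_space_imp_surjective[OF cover_facts(3)] inj covering_space_open_image[OF cover_facts(3)]]
    by blast
  then have "continuous_on M q" "q ` M = Mt" unfolding homeomorphism_def by auto
  then have "compact Mt" using compact_continuous_image[of M q] cover_facts(1) by simp
  then have "compact (d ` Mt)" using compact_continuous_image[OF contd] by blast
  \<comment> \<open>The index type is nonempty, so the dimension is positive and \<open>UNIV\<close>
    is unbounded.\<close>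
  moreover have "d ` Mt = UNIV" using g(2,3) by (metis PiE UNIV_I UNIV_eq_I image_eqI)
  ultimately show False using compact_imp_bounded not_bounded_UNIV by metis
qed

end

theorem theorem3:
  fixes M :: "'m::t2_space set"
    and A :: "('m set \<times> ('m \<Rightarrow> real^'n)) set"
    and Mt :: "'c::topological_space set"
    and p :: "'c \<Rightarrow> 'm"
    and dev :: "'c \<Rightarrow> real^'n"
    and hol :: "('c \<Rightarrow> 'c) \<Rightarrow> (real^'n \<Rightarrow> real^'n)"
    and x0 :: "real^'n"
  assumes "closed_affine_manifold M A"
    and "universal_cover Mt p M"
    and "developing_map Mt p A dev"
    and "holonomy Mt p dev hol"
    and "\<forall>\<gamma>. deck_transformation Mt p \<gamma> \<longrightarrow> hol \<gamma> x0 = x0"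
  shows "x0 \<notin> dev ` Mt"
proof -
  let ?d = "\<lambda>z. dev z - x0"
  have "0 \<notin> ?d ` Mt"
  proof (rule zero_notin_developing_image[OF assms(1,2)])
    show "developing_map Mt p A ?d"
      unfolding developing_map_def
    proof
      fix x assume "x \<in> Mt"
      then obtain W U \<phi> T where W: "x \<in> W" "openin (top_of_set Mt) W" "(U, \<phi>) \<in> A"
        "p ` W \<subseteq> U" "affine_aut T" "\<forall>y\<in>W. dev y = T (\<phi> (p y))"
        using assms(3) unfolding developing_map_def by metis
      obtain L b where L: "linear L" "bij L" "T = (\<lambda>x. L x + b)"
        using W(5) unfolding affine_aut_def by blast
      \<comment> \<open>The translation is absorbed into the affine map, so the atlas stays
        unchanged.\<close>
      have "affine_aut (\<lambda>y. T y - x0)"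
        unfolding affine_aut_def using L by (intro exI[of _ L] exI[of _ "b - x0"]) (auto simp: algebra_simps)
      then show "\<exists>W U \<phi> T. x \<in> W \<and> openin (top_of_set Mt) W \<and> (U, \<phi>) \<in> A \<and> p ` W \<subseteq> U \<and>
          affine_aut T \<and> (\<forall>y\<in>W. dev y - x0 = T (\<phi> (p y)))"
        using W(1-4,6)
        by (intro exI[of _ W] exI[of _ U] exI[of _ \<phi>] exI[of _ "\<lambda>y. T y - x0"]) simp
    qed
    fix \<gamma> assume \<gamma>: "deck_transformation Mt p \<gamma>"
    then have "affine_aut (hol \<gamma>)" and dev: "\<forall>y\<in>Mt. dev (\<gamma> y) = hol \<gamma> (dev y)"
      using assms(4) unfolding holonomy_def by auto
    then obtain L b where L: "linear L" "bij L" "hol \<gamma> = (\<lambda>x. L x + b)"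
      unfolding affine_aut_def by blast
    \<comment> \<open>The fixed-point equation cancels \<open>b\<close>: conjugation by the
      translation leaves exactly the linear part \<open>L\<close>.\<close>
    have fix_x0: "L x0 + b = x0" using assms(5) \<gamma> L(3) by metis
    have "dev (\<gamma> y) - x0 = L (dev y - x0)" if "y \<in> Mt" for y
    proof -
      have "dev (\<gamma> y) - x0 = (L (dev y) + b) - (L x0 + b)"
        using dev that L(3) fix_x0 by simp
      then show ?thesis by (simp add: linear_diff[OF L(1)])
    qed
    then show "\<exists>L. linear L \<and> bij L \<and> (\<forall>y\<in>Mt. dev (\<gamma> y) - x0 = L (dev y - x0))"
      using L(1,2) by blast
  qed
  then show ?thesis by force
qed

end
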